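(* For every prime power $q$ there exists a $(9,2)$-set $X_q$ in $\mathrm{PG}(4,q)$ with $|X_q| = (1+o(1))\, q^2$ as $q \to \infty$.
   Context: $\mathrm{PG}(4,q)$ is the projective space whose points are the $1$-dimensional subspaces of $\mathbb{F}_q^{5}$; a plane is a $3$-dimensional vector subspace. A $(9,2)$-set is a set of points such that every plane contains at most $9$ of its points. *)

theory Defs
  imports
    "Jordan_Normal_Form.Missing_VectorSpace"
    "HOL-Number_Theory.Prime_Powers"
    "HOL-Library.Landau_Symbols"
begin

abbreviation coord_space :: "('a, 'm) ring_scheme \<Rightarrow> nat \<Rightarrow> ('a, nat \<Rightarrow> 'a) module"
  where "coord_space K n \<equiv> ring.func_space K {..<n}"

text \<open>
  Everything below uses vector space dimensions: in the projective space \<open>PG(n, K)\<close> of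
  \<open>K\<^bsup>n+1\<^esup>\<close>, points are the subspaces of dimension 1 and planes those of dimension 3.
\<close>

definition subspaces_of_dim ::
    "('a, 'm) ring_scheme \<Rightarrow> nat \<Rightarrow> nat \<Rightarrow> (nat \<Rightarrow> 'a) set set"
  where "subspaces_of_dim K n d =
    {W. VectorSpace.subspace K W (coord_space K n) \<and>
        vectorspace.dim K ((coord_space K n)\<lparr>carrier := W\<rparr>) = d}"

definition PG_points :: "nat \<Rightarrow> ('a, 'm) ring_scheme \<Rightarrow> (nat \<Rightarrow> 'a) set set"
  where "PG_points n K = subspaces_of_dim K (n + 1) 1"

definition PG_planes :: "nat \<Rightarrow> ('a, 'm) ring_scheme \<Rightarrow> (nat \<Rightarrow> 'a) set set"
  where "PG_planes n K = subspaces_of_dim K (n + 1) 3"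

definition nine_two_set :: "nat \<Rightarrow> ('a, 'm) ring_scheme \<Rightarrow> (nat \<Rightarrow> 'a) set set \<Rightarrow> bool"
  where "nine_two_set n K X \<longleftrightarrow>
    X \<subseteq> PG_points n K \<and> (\<forall>E \<in> PG_planes n K. card {P \<in> X. P \<subseteq> E} \<le> 9)"

end

theory Submission
  imports Defs
begin

text \<open>
  Over any finite field there are an anisotropic binary quadratic form \<open>f = x\<^sup>2 - xy - cy\<^sup>2\<close> and an
  anisotropic binary cubic form \<open>g = x\<^sup>3 - xy\<^sup>2 - ey\<^sup>3\<close>: the maps \<open>t \<mapsto> t\<^sup>2 - t\<close> and
  \<open>t \<mapsto> t\<^sup>3 - t\<close> identify 0 and 1, hence miss some values \<open>c\<close> and \<open>e\<close>. The set consists of the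
  \<open>q\<^sup>2\<close> points \<open>(1 : x : y : f : g)\<close>. A plane is cut out by two independent linear
  equations in \<open>1, x, y, f, g\<close>. If some combination of them involves only \<open>1, x, y\<close>, then it confines
  \<open>(x, y)\<close> to a line, on which \<open>f\<close> and \<open>g\<close> have exact degrees 2 and 3 by anisotropy, so the other
  equation has at most 3 solutions there. Otherwise the equations read \<open>f = l\<close>, \<open>g = m\<close> with affine
  \<open>l\<close>, \<open>m\<close>; eliminating \<open>x\<close> leaves at most 8 solutions.
\<close>

section \<open>Polynomial functions\<close>

lemma (in ring) eq_if_minus_zero:
  assumes "a \<ominus> b = \<zero>" "a \<in> carrier R" "b \<in> carrier R"
  shows "a = b"
proof -
  have "a = (a \<ominus> b) \<oplus> b"
    using assms(2,3) by (simp add: a_minus_def a_assoc l_neg)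
  with assms show ?thesis by simp
qed

text \<open>
  \<open>poly_fun n a f\<close>: on the carrier, \<open>f\<close> is a polynomial of formal degree \<open>n\<close> in Horner form whose
  coefficient of \<open>t\<^sup>n\<close> is \<open>a\<close>; \<open>a\<close> may be zero.
\<close>

primrec (in ring) poly_fun :: "nat \<Rightarrow> 'a \<Rightarrow> ('a \<Rightarrow> 'a) \<Rightarrow> bool"
  where
    "poly_fun 0 a f \<longleftrightarrow> a \<in> carrier R \<and> (\<forall>t\<in>carrier R. f t = a)"
  | "poly_fun (Suc n) a f \<longleftrightarrow>
      (\<exists>g b. poly_fun n a g \<and> b \<in> carrier R \<and> (\<forall>t\<in>carrier R. f t = t \<otimes> g t \<oplus> b))"

context cring
begin

lemma poly_fun_closed:
  assumes "poly_fun n a f"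
  shows "a \<in> carrier R" "t \<in> carrier R \<Longrightarrow> f t \<in> carrier R"
  using assms by (induction n arbitrary: f) auto

lemma poly_fun_const: "a \<in> carrier R \<Longrightarrow> poly_fun 0 a (\<lambda>t. a)"
  by simp

lemma poly_fun_ident: "poly_fun 1 \<one> (\<lambda>t. t)"
  by (auto intro!: exI[of _ "\<lambda>t. \<one>"] bexI[of _ \<zero>])

lemma poly_fun_cong:
  assumes "poly_fun n a f" "\<And>t. t \<in> carrier R \<Longrightarrow> f t = g t"
  shows "poly_fun n a g"
  using assms by (cases n) auto

lemma poly_fun_pad:
  assumes "poly_fun n a f"
  shows "poly_fun (Suc n) \<zero> f"
  using assms
proof (induction n arbitrary: f)
  case 0
  then show ?case by (auto intro!: exI[of _ "\<lambda>t. \<zero>"])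
next
  case (Suc n)
  then obtain g b where "poly_fun n a g" "b \<in> carrier R" "\<forall>t\<in>carrier R. f t = t \<otimes> g t \<oplus> b"
    by auto
  with Suc.IH[of g] show ?case by (subst poly_fun.simps(2)) blast
qed

text \<open>Lower-order terms count as terms of any higher formal degree with leading coefficient
  zero, so they can be added without disturbing the leading coefficient.\<close>

lemma poly_fun_zero_lead:
  assumes "poly_fun m a f" "m < n"
  shows "poly_fun n \<zero> f"
proof -
  have "poly_fun (Suc (m + d)) \<zero> f" for d
    by (induction d) (use poly_fun_pad assms(1) in \<open>simp_all del: poly_fun.simps\<close>)
  then show ?thesis
    using assms(2) less_imp_Suc_add by blast
qed

lemma poly_fun_add:
  assumes "poly_fun n a f" "poly_fun n b g"
  shows "poly_fun n (a \<oplus> b) (\<lambda>t. f t \<oplus> g t)"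
  using assms
proof (induction n arbitrary: f g)
  case 0
  then show ?case by simp
next
  case (Suc n)
  then obtain f' k g' l
    where f': "poly_fun n a f'" "k \<in> carrier R" "\<forall>t\<in>carrier R. f t = t \<otimes> f' t \<oplus> k"
      and g': "poly_fun n b g'" "l \<in> carrier R" "\<forall>t\<in>carrier R. g t = t \<otimes> g' t \<oplus> l"
    by auto
  have "f t \<oplus> g t = t \<otimes> (f' t \<oplus> g' t) \<oplus> (k \<oplus> l)" if t: "t \<in> carrier R" for t
    using t f' g' poly_fun_closed(2)[OF f'(1) t] poly_fun_closed(2)[OF g'(1) t]
    by (simp add: r_distr a_ac)
  with Suc.IH[OF f'(1) g'(1)] f'(2) g'(2) show ?case
    by (auto intro!: exI[of _ "\<lambda>t. f' t \<oplus> g' t"] bexI[of _ "k \<oplus> l"])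
qed

lemma poly_fun_add_lower:
  assumes "poly_fun n a f" "poly_fun m b g" "m < n"
  shows "poly_fun n a (\<lambda>t. f t \<oplus> g t)" "poly_fun n a (\<lambda>t. g t \<oplus> f t)"
  using poly_fun_add[OF assms(1) poly_fun_zero_lead[OF assms(2,3)]]
    poly_fun_add[OF poly_fun_zero_lead[OF assms(2,3)] assms(1)]
    poly_fun_closed(1)[OF assms(1)] by simp_all

lemma poly_fun_smult:
  assumes "poly_fun n a f" "k \<in> carrier R"
  shows "poly_fun n (k \<otimes> a) (\<lambda>t. k \<otimes> f t)"
  using assms
proof (induction n arbitrary: f)
  case 0
  then show ?case by simp
next
  case (Suc n)
  then obtain g b where g: "poly_fun n a g" "b \<in> carrier R" "\<forall>t\<in>carrier R. f t = t \<otimes> g t \<oplus> b"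
    by auto
  have "k \<otimes> f t = t \<otimes> (k \<otimes> g t) \<oplus> k \<otimes> b" if t: "t \<in> carrier R" for t
    using t g Suc.prems(2) poly_fun_closed(2)[OF g(1) t] by (simp add: r_distr m_lcomm)
  with Suc.IH[OF g(1) Suc.prems(2)] g(2) Suc.prems(2) show ?case
    by (auto intro!: exI[of _ "\<lambda>t. k \<otimes> g t"] bexI[of _ "k \<otimes> b"])
qed

lemma poly_fun_minus:
  assumes "poly_fun n a f" "poly_fun n b g"
  shows "poly_fun n (a \<ominus> b) (\<lambda>t. f t \<ominus> g t)"
proof -
  have "poly_fun n (a \<oplus> (\<ominus> \<one>) \<otimes> b) (\<lambda>t. f t \<oplus> (\<ominus> \<one>) \<otimes> g t)"
    using assms by (intro poly_fun_add poly_fun_smult) simp_all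
  moreover have "a \<oplus> (\<ominus> \<one>) \<otimes> b = a \<ominus> b"
    using poly_fun_closed(1)[OF assms(2)] by (simp add: l_minus a_minus_def)
  ultimately show ?thesis
    using poly_fun_closed(2)[OF assms(2)]
    by (auto elim!: poly_fun_cong simp: l_minus a_minus_def)
qed

lemma poly_fun_minus_lower:
  assumes "poly_fun n a f" "poly_fun m b g" "m < n"
  shows "poly_fun n a (\<lambda>t. f t \<ominus> g t)"
  using poly_fun_minus[OF assms(1) poly_fun_zero_lead[OF assms(2,3)]] poly_fun_closed(1)[OF assms(1)]
  by (simp add: a_minus_def)

text \<open>Induction on the Horner form of the first factor. The degree is a variable
  \<open>k\<close> with an equation so that numerals such as 2 and 3 unify with it.\<close>

lemma poly_fun_mult:
  assumes "poly_fun m a f" "poly_fun n b g" "k = m + n"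
  shows "poly_fun k (a \<otimes> b) (\<lambda>t. f t \<otimes> g t)"
  unfolding assms(3) using assms(1)
proof (induction m arbitrary: f)
  case 0
  then have "poly_fun n (a \<otimes> b) (\<lambda>t. a \<otimes> g t)"
    using assms(2) by (intro poly_fun_smult) simp_all
  with 0 show ?case by (auto elim: poly_fun_cong)
next
  case (Suc m)
  then obtain f' k where f': "poly_fun m a f'" "k \<in> carrier R" "\<forall>t\<in>carrier R. f t = t \<otimes> f' t \<oplus> k"
    by auto
  note closed = poly_fun_closed[OF f'(1)] poly_fun_closed[OF assms(2)]
  have "poly_fun (Suc (m + n)) (a \<otimes> b) (\<lambda>t. t \<otimes> (f' t \<otimes> g t) \<oplus> \<zero>)"
    using Suc.IH[OF f'(1)] by auto
  moreover have "poly_fun (Suc (m + n)) \<zero> (\<lambda>t. k \<otimes> g t)"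
    by (rule poly_fun_zero_lead[OF poly_fun_smult[OF assms(2) f'(2)]]) simp
  ultimately have "poly_fun (Suc (m + n)) (a \<otimes> b \<oplus> \<zero>) (\<lambda>t. (t \<otimes> (f' t \<otimes> g t) \<oplus> \<zero>) \<oplus> k \<otimes> g t)"
    by (rule poly_fun_add)
  then show ?case
    using f'(2,3) closed by (auto elim!: poly_fun_cong simp: l_distr m_assoc)
qed

text \<open>Synthetic division: f t - f r = t (g t - g r) + (t - r) g r, and t - r divides the first
  difference by induction.\<close>

lemma poly_fun_factor:
  assumes "poly_fun (Suc n) a f" "r \<in> carrier R"
  shows "\<exists>h. poly_fun n a h \<and> (\<forall>t\<in>carrier R. f t \<ominus> f r = (t \<ominus> r) \<otimes> h t)"
  using assms(1)
proof (induction n arbitrary: f)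
  case 0
  then obtain b where "a \<in> carrier R" "b \<in> carrier R" "\<forall>t\<in>carrier R. f t = t \<otimes> a \<oplus> b"
    by auto
  moreover have "(t \<otimes> a \<oplus> b) \<ominus> (r \<otimes> a \<oplus> b) = (t \<ominus> r) \<otimes> a"
    if "t \<in> carrier R" "a \<in> carrier R" "b \<in> carrier R" for t
    using that assms(2) by algebra
  ultimately show ?case
    using assms(2) by (intro exI[of _ "\<lambda>t. a"]) simp
next
  case (Suc n)
  then obtain g b where g: "poly_fun (Suc n) a g" "b \<in> carrier R" "\<forall>t\<in>carrier R. f t = t \<otimes> g t \<oplus> b"
    by (auto simp del: poly_fun.simps(2) simp: poly_fun.simps(2)[of "Suc n"])
  then obtain h where h: "poly_fun n a h" "\<forall>t\<in>carrier R. g t \<ominus> g r = (t \<ominus> r) \<otimes> h t"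
    using Suc.IH by blast
  note closed = poly_fun_closed[OF g(1)] poly_fun_closed[OF h(1)]
  have "poly_fun (Suc n) a (\<lambda>t. t \<otimes> h t \<oplus> g r)"
    using h(1) closed assms(2) by auto
  moreover have "f t \<ominus> f r = (t \<ominus> r) \<otimes> (t \<otimes> h t \<oplus> g r)" if t: "t \<in> carrier R" for t
  proof -
    have "f t \<ominus> f r = t \<otimes> (g t \<ominus> g r) \<oplus> (t \<ominus> r) \<otimes> g r"
      using t g(2,3) assms(2) closed(2)[OF t] closed(2)[OF assms(2)] by simp algebra
    also have "\<dots> = t \<otimes> ((t \<ominus> r) \<otimes> h t) \<oplus> (t \<ominus> r) \<otimes> g r"
      using h(2) t by simp
    also have "\<dots> = (t \<ominus> r) \<otimes> (t \<otimes> h t \<oplus> g r)"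
      using t assms(2) closed(4)[OF t] closed(2)[OF assms(2)] by algebra
    finally show ?thesis .
  qed
  ultimately show ?case by blast
qed

declare poly_fun.simps [simp del]

end

text \<open>A root \<open>r\<close> splits off a factor t - r, whose cofactor has the same nonzero
  leading coefficient and vanishes at every other root. Finiteness is part of the claim, since an
  infinite set has \<open>card\<close> 0.\<close>

lemma (in domain) card_zeros_poly_fun_le:
  assumes "poly_fun n a f" "a \<noteq> \<zero>"
  shows "finite {t \<in> carrier R. f t = \<zero>} \<and> card {t \<in> carrier R. f t = \<zero>} \<le> n"
  using assms
proof (induction n arbitrary: f)
  case 0
  then have empty: "{t \<in> carrier R. f t = \<zero>} = {}" by (auto simp: poly_fun.simps)
  show ?case unfolding empty by simp
next
  case (Suc n)
  show ?case
  proof (cases "\<exists>r\<in>carrier R. f r = \<zero>")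
    case False
    then have empty: "{t \<in> carrier R. f t = \<zero>} = {}" by blast
    show ?thesis unfolding empty by simp
  next
    case True
    then obtain r where r: "r \<in> carrier R" "f r = \<zero>" by blast
    obtain h where h: "poly_fun n a h" "\<forall>t\<in>carrier R. f t \<ominus> f r = (t \<ominus> r) \<otimes> h t"
      using poly_fun_factor[OF Suc.prems(1) r(1)] by blast
    have "{t \<in> carrier R. f t = \<zero>} \<subseteq> insert r {t \<in> carrier R. h t = \<zero>}"
    proof clarify
      fix t assume t: "t \<in> carrier R" "f t = \<zero>" "t \<noteq> r"
      then have "(t \<ominus> r) \<otimes> h t = \<zero>"
        using h(2) r by (metis minus_eq r_neg r_zero zero_closed)
      moreover have "t \<ominus> r \<noteq> \<zero>" using t r eq_if_minus_zero by blast
      ultimately show "h t = \<zero>"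
        using t r poly_fun_closed(2)[OF h(1)] by (simp add: integral_iff)
    qed
    moreover have IH: "finite {t \<in> carrier R. h t = \<zero>}" "card {t \<in> carrier R. h t = \<zero>} \<le> n"
      using Suc.IH[OF h(1) Suc.prems(2)] by simp_all
    moreover have "card (insert r {t \<in> carrier R. h t = \<zero>}) \<le> Suc n"
      using IH by (simp add: card_insert_if)
    ultimately show ?thesis
      by (meson card_mono finite_insert finite_subset le_trans)
  qed
qed

section \<open>Anisotropic binary forms\<close>

text \<open>Homogenisation of t^2 - t - c, as \<open>cform\<close> below is of t^3 - t - e; both
  shapes work in every characteristic.\<close>

definition (in ring) qform :: "'a \<Rightarrow> 'a \<Rightarrow> 'a \<Rightarrow> 'a"
  where "qform c x y = x \<otimes> x \<ominus> x \<otimes> y \<ominus> c \<otimes> y \<otimes> y"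

definition (in ring) cform :: "'a \<Rightarrow> 'a \<Rightarrow> 'a \<Rightarrow> 'a"
  where "cform e x y = x \<otimes> x \<otimes> x \<ominus> x \<otimes> y \<otimes> y \<ominus> e \<otimes> y \<otimes> y \<otimes> y"

lemma (in ring) form_closed [simp]:
  assumes "c \<in> carrier R" "x \<in> carrier R" "y \<in> carrier R"
  shows "qform c x y \<in> carrier R" "cform c x y \<in> carrier R"
  using assms by (simp_all add: qform_def cform_def)

text \<open>Along a line with direction (u, v) the leading coefficient is the form at (u, v); for an
  anisotropic form it is nonzero unless u = v = 0. The cubic form behaves alike.\<close>

lemma (in cring) poly_fun_qform:
  assumes f: "poly_fun 1 u f" and g: "poly_fun 1 v g" and c: "c \<in> carrier R"
  shows "poly_fun 2 (qform c u v) (\<lambda>t. qform c (f t) (g t))"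
  unfolding qform_def
  by (intro poly_fun_minus poly_fun_mult[OF f f] poly_fun_mult[OF f g]
      poly_fun_mult[OF poly_fun_smult[OF g c] g]) simp_all

lemma (in cring) poly_fun_cform:
  assumes f: "poly_fun 1 u f" and g: "poly_fun 1 v g" and e: "e \<in> carrier R"
  shows "poly_fun 3 (cform e u v) (\<lambda>t. cform e (f t) (g t))"
  unfolding cform_def
  by (intro poly_fun_minus poly_fun_mult[OF poly_fun_mult[OF f f refl] f]
      poly_fun_mult[OF poly_fun_mult[OF f g refl] g]
      poly_fun_mult[OF poly_fun_mult[OF poly_fun_smult[OF g e] g refl] g]) simp_all

lemma (in field) linear_eq_solution:
  assumes eq: "k0 \<oplus> k1 \<otimes> z = \<zero>" and "k1 \<noteq> \<zero>"
    and closed: "k0 \<in> carrier R" "k1 \<in> carrier R" "z \<in> carrier R"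
  shows "z = (\<ominus> (inv k1)) \<otimes> k0"
proof -
  have k1: "k1 \<in> Units R" using assms by (simp add: field_Units)
  have "k1 \<otimes> z = \<ominus> k0"
    using eq closed by (metis add.inv_equality add.m_comm m_closed)
  then have "inv k1 \<otimes> (k1 \<otimes> z) = inv k1 \<otimes> (\<ominus> k0)" by simp
  then show ?thesis
    using k1 closed by (simp add: m_assoc[symmetric] l_minus r_minus)
qed

text \<open>A self-map of a finite set that identifies two points must miss a value.\<close>

lemma (in field) nonsurjective_if_collision:
  assumes fin: "finite (carrier R)" and h: "h \<in> carrier R \<rightarrow> carrier R" and "h \<zero> = h \<one>"
  obtains c where "c \<in> carrier R" "c \<notin> h ` carrier R"
proof -
  have "\<not> inj_on h (carrier R)"
    using assms(3) zero_not_one by (metis inj_on_def one_closed zero_closed)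
  then have "h ` carrier R \<noteq> carrier R"
    using fin eq_card_imp_inj_on[of "carrier R" h] by auto
  then show thesis
    using h that by (auto simp: Pi_iff)
qed

text \<open>With t = x/y the form is y^2 (t^2 - t - c), and \<open>c\<close> is a value that t^2 - t
  misses; for y = 0 the form is x^2.\<close>

lemma (in field) ex_anisotropic_qform:
  assumes fin: "finite (carrier R)"
  obtains c where "c \<in> carrier R"
    "\<And>x y. \<lbrakk>x \<in> carrier R; y \<in> carrier R; (x, y) \<noteq> (\<zero>, \<zero>)\<rbrakk> \<Longrightarrow> qform c x y \<noteq> \<zero>"
proof -
  obtain c where c [simp]: "c \<in> carrier R" "c \<notin> (\<lambda>t. t \<otimes> t \<ominus> t) ` carrier R"
    using fin by (rule nonsurjective_if_collision[where h = "\<lambda>t. t \<otimes> t \<ominus> t"]) (simp_all add: a_minus_def r_neg)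
  have "qform c x y \<noteq> \<zero>" if [simp]: "x \<in> carrier R" "y \<in> carrier R" and nz: "(x, y) \<noteq> (\<zero>, \<zero>)" for x y
  proof (cases "y = \<zero>")
    case True
    then have "qform c x y = x \<otimes> x"
      by (simp add: qform_def a_minus_def)
    with True nz show ?thesis by (simp add: integral_iff)
  next
    case False
    then have y: "y \<in> Units R" by (simp add: field_Units)
    define t where "t = x \<otimes> inv y"
    have t [simp]: "t \<in> carrier R" and x: "x = t \<otimes> y"
      using y by (simp_all add: t_def m_assoc)
    have "qform c x y = y \<otimes> y \<otimes> ((t \<otimes> t \<ominus> t) \<ominus> c)"
      unfolding qform_def x using c(1) t \<open>y \<in> carrier R\<close> by algebra
    moreover have "(t \<otimes> t \<ominus> t) \<ominus> c \<noteq> \<zero>"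
      using c(2) by (metis (no_types, lifting) c(1) eq_if_minus_zero imageI m_closed minus_closed t)
    ultimately show ?thesis
      using False by (simp add: integral_iff)
  qed
  with c(1) show thesis by (rule that)
qed

text \<open>The argument for the quadratic form carries over with y^3 (t^3 - t - e) and x^3.\<close>

lemma (in field) ex_anisotropic_cform:
  assumes fin: "finite (carrier R)"
  obtains e where "e \<in> carrier R"
    "\<And>x y. \<lbrakk>x \<in> carrier R; y \<in> carrier R; (x, y) \<noteq> (\<zero>, \<zero>)\<rbrakk> \<Longrightarrow> cform e x y \<noteq> \<zero>"
proof -
  obtain e where e [simp]: "e \<in> carrier R" "e \<notin> (\<lambda>t. t \<otimes> t \<otimes> t \<ominus> t) ` carrier R"
    using fin by (rule nonsurjective_if_collision[where h = "\<lambda>t. t \<otimes> t \<otimes> t \<ominus> t"]) (simp_all add: a_minus_def r_neg)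
  have "cform e x y \<noteq> \<zero>" if [simp]: "x \<in> carrier R" "y \<in> carrier R" and nz: "(x, y) \<noteq> (\<zero>, \<zero>)" for x y
  proof (cases "y = \<zero>")
    case True
    then have "cform e x y = x \<otimes> x \<otimes> x"
      by (simp add: cform_def a_minus_def)
    with True nz show ?thesis by (simp add: integral_iff)
  next
    case False
    then have y: "y \<in> Units R" by (simp add: field_Units)
    define t where "t = x \<otimes> inv y"
    have t [simp]: "t \<in> carrier R" and x: "x = t \<otimes> y"
      using y by (simp_all add: t_def m_assoc)
    have "cform e x y = y \<otimes> y \<otimes> y \<otimes> ((t \<otimes> t \<otimes> t \<ominus> t) \<ominus> e)"
      unfolding cform_def x using e(1) t \<open>y \<in> carrier R\<close> by algebra
    moreover have "(t \<otimes> t \<otimes> t \<ominus> t) \<ominus> e \<noteq> \<zero>"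
      using e(2) by (metis (no_types, lifting) e(1) eq_if_minus_zero imageI m_closed minus_closed t)
    ultimately show ?thesis
      using False by (simp add: integral_iff)
  qed
  with e(1) show thesis by (rule that)
qed

section \<open>Counting common points of conics, cubics and lines in the affine plane\<close>

locale anisotropic_forms = field R for R (structure) +
  fixes c e
  assumes finite_carrier: "finite (carrier R)"
    and c_closed [simp]: "c \<in> carrier R" and e_closed [simp]: "e \<in> carrier R"
    and qform_nonzero: "\<lbrakk>x \<in> carrier R; y \<in> carrier R; (x, y) \<noteq> (\<zero>, \<zero>)\<rbrakk> \<Longrightarrow> qform c x y \<noteq> \<zero>"
    and cform_nonzero: "\<lbrakk>x \<in> carrier R; y \<in> carrier R; (x, y) \<noteq> (\<zero>, \<zero>)\<rbrakk> \<Longrightarrow> cform e x y \<noteq> \<zero>"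
begin

text \<open>The value of the linear functional \<open>a\<close> at the vector (1, x, y, f, g),
  written out term by term so that polynomial arithmetic applies; \<open>dot_surface_vec\<close>
  gives the link to \<open>dot\<close>.\<close>

definition functional_on_surface :: "(nat \<Rightarrow> 'a) \<Rightarrow> 'a \<Rightarrow> 'a \<Rightarrow> 'a"
  where "functional_on_surface a x y =
    a 0 \<oplus> a 1 \<otimes> x \<oplus> a 2 \<otimes> y \<oplus> a 3 \<otimes> qform c x y \<oplus> a 4 \<otimes> cform e x y"

definition hyperplane_section :: "(nat \<Rightarrow> 'a) \<Rightarrow> ('a \<times> 'a) set"
  where "hyperplane_section a = {(x, y). x \<in> carrier R \<and> y \<in> carrier R \<and> functional_on_surface a x y = \<zero>}"

text \<open>The quadratic form takes the value -c at (0, 1). As \<open>c\<close> is the leading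
  coefficient of \<open>A\<close> below, \<open>A\<close> has exact degree 2.\<close>

lemma c_nonzero: "c \<noteq> \<zero>"
  using qform_nonzero[of \<zero> \<one>] by (auto simp: qform_def a_minus_def)

lemma finite_hyperplane_section: "finite (hyperplane_section a)"
  using finite_carrier by (rule_tac finite_subset[of _ "carrier R \<times> carrier R"]) (auto simp: hyperplane_section_def)

text \<open>
  With \<open>L = y + a1\<close> and \<open>Q = cy\<^sup>2 + a2y + a0\<close> the conic reads \<open>x\<^sup>2 = xL + Q\<close>. It reduces the cubic to
  \<open>A(y)x = B(y)\<close> with \<open>deg A = 2\<close>, \<open>deg B \<le> 3\<close>, and then \<open>B\<^sup>2 - ABL - A\<^sup>2Q\<close> vanishes at \<open>y\<close>. Its
  coefficient of \<open>y\<^sup>6\<close> is a nonzero value of the quadratic form. A root \<open>y\<close> of this resultant extends to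
  one solution, or to at most two if \<open>A(y) = 0\<close>, which gives the bound 6 + 2.
\<close>

lemma card_conic_inter_cubic:
  assumes closed [simp]: "a0 \<in> carrier R" "a1 \<in> carrier R" "a2 \<in> carrier R"
    "b0 \<in> carrier R" "b1 \<in> carrier R" "b2 \<in> carrier R"
  defines "S \<equiv> {(x, y). x \<in> carrier R \<and> y \<in> carrier R \<and>
    qform c x y = a0 \<oplus> a1 \<otimes> x \<oplus> a2 \<otimes> y \<and> cform e x y = b0 \<oplus> b1 \<otimes> x \<oplus> b2 \<otimes> y}"
  shows "card S \<le> 8"
proof -
  define L where "L y = y \<oplus> a1" for y
  define Q where "Q y = c \<otimes> y \<otimes> y \<oplus> a2 \<otimes> y \<oplus> a0" for y
  define A where "A y = (L y \<otimes> L y \<oplus> Q y) \<ominus> y \<otimes> y \<ominus> b1" for y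
  define B where "B y = e \<otimes> y \<otimes> y \<otimes> y \<ominus> L y \<otimes> Q y \<oplus> b2 \<otimes> y \<oplus> b0" for y
  define r where "r y = B y \<otimes> B y \<ominus> B y \<otimes> A y \<otimes> L y \<ominus> Q y \<otimes> A y \<otimes> A y" for y
  note const = poly_fun_const and ident = poly_fun_ident
  have deg1: "poly_fun 1 k (\<lambda>y. k \<otimes> y)" if "k \<in> carrier R" for k
    using poly_fun_smult[OF ident that] that by simp
  have deg2: "poly_fun 2 k (\<lambda>y. k \<otimes> y \<otimes> y)" if "k \<in> carrier R" for k
    using poly_fun_mult[OF deg1[OF that] ident, of 2] that by simp
  have yy: "poly_fun 2 \<one> (\<lambda>y. y \<otimes> y)"
    using poly_fun_mult[OF ident ident, of 2] by simp
  have deg3: "poly_fun 3 k (\<lambda>y. k \<otimes> y \<otimes> y \<otimes> y)" if "k \<in> carrier R" for k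
    using poly_fun_mult[OF deg2[OF that] ident, of 3] that by simp
  have L: "poly_fun 1 \<one> L"
    unfolding L_def by (rule poly_fun_add_lower(1)[OF ident const]) simp_all
  have Q: "poly_fun 2 c Q"
    unfolding Q_def by (rule poly_fun_add_lower(1)[OF poly_fun_add_lower(1)[OF deg2 deg1] const]) simp_all
  have "poly_fun 2 (\<one> \<otimes> \<one> \<oplus> c \<ominus> \<one>) A"
    unfolding A_def
    by (intro poly_fun_minus_lower[OF _ const] poly_fun_minus poly_fun_add poly_fun_mult[OF L L] Q yy) simp_all
  \<comment> \<open>The leading terms of L^2 and y^2 cancel, so only the coefficient
    \<open>c\<close> of \<open>Q\<close> survives.\<close>
  then have A: "poly_fun 2 c A"
    by (simp add: a_minus_def a_ac r_neg)
  have "poly_fun 3 (e \<ominus> \<one> \<otimes> c) B"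
    unfolding B_def
    by (intro poly_fun_add_lower(1)[OF _ const] poly_fun_add_lower(1)[OF _ deg1] poly_fun_minus
        deg3 poly_fun_mult[OF L Q]) simp_all
  then have B: "poly_fun 3 (e \<ominus> c) B" by simp
  have r: "poly_fun 6 ((e \<ominus> c) \<otimes> (e \<ominus> c) \<ominus> (e \<ominus> c) \<otimes> c \<otimes> \<one> \<ominus> c \<otimes> c \<otimes> c) r"
    unfolding r_def
    by (intro poly_fun_minus poly_fun_mult[OF B B] poly_fun_mult[OF poly_fun_mult[OF B A refl] L]
        poly_fun_mult[OF poly_fun_mult[OF Q A refl] A]) simp_all
  \<comment> \<open>The form is read at (e - c, c), a nonzero vector because \<open>c\<close> is
    nonzero.\<close>
  have "(e \<ominus> c) \<otimes> (e \<ominus> c) \<ominus> (e \<ominus> c) \<otimes> c \<otimes> \<one> \<ominus> c \<otimes> c \<otimes> c = qform c (e \<ominus> c) c"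
    by (simp add: qform_def)
  also have "\<dots> \<noteq> \<zero>"
    using c_nonzero by (intro qform_nonzero) auto
  finally have lead: "(e \<ominus> c) \<otimes> (e \<ominus> c) \<ominus> (e \<ominus> c) \<otimes> c \<otimes> \<one> \<ominus> c \<otimes> c \<otimes> c \<noteq> \<zero>" .
  define Y where "Y = {y \<in> carrier R. r y = \<zero>}"
  define Z where "Z = {y \<in> carrier R. A y = \<zero>}"
  have Y: "finite Y" "card Y \<le> 6"
    unfolding Y_def using card_zeros_poly_fun_le[OF r lead] by simp_all
  have Z: "finite Z" "card Z \<le> 2"
    unfolding Z_def using card_zeros_poly_fun_le[OF A c_nonzero] by simp_all
  note fun_closed = poly_fun_closed(2)[OF L] poly_fun_closed(2)[OF Q] poly_fun_closed(2)[OF A] poly_fun_closed(2)[OF B]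
  have reduced: "x \<otimes> x = x \<otimes> L y \<oplus> Q y \<and> A y \<otimes> x = B y" if "(x, y) \<in> S" for x y
  proof
    have x: "x \<in> carrier R" and y: "y \<in> carrier R"
      and f: "x \<otimes> x \<ominus> x \<otimes> y \<ominus> c \<otimes> y \<otimes> y = a0 \<oplus> a1 \<otimes> x \<oplus> a2 \<otimes> y"
      and g: "cform e x y = b0 \<oplus> b1 \<otimes> x \<oplus> b2 \<otimes> y"
      using that by (auto simp: S_def qform_def)
    have "x \<otimes> x = (x \<otimes> x \<ominus> x \<otimes> y \<ominus> c \<otimes> y \<otimes> y) \<oplus> (x \<otimes> y \<oplus> c \<otimes> y \<otimes> y)"
      using x y c_closed by algebra
    also have "\<dots> = x \<otimes> L y \<oplus> Q y"
      unfolding f L_def Q_def using x y c_closed closed by algebra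
    finally show xx: "x \<otimes> x = x \<otimes> L y \<oplus> Q y" .
    \<comment> \<open>Two uses of x^2 = x L + Q turn x^3 into x (L^2 + Q) + L Q.\<close>
    have "x \<otimes> x \<otimes> x = (x \<otimes> x) \<otimes> L y \<oplus> x \<otimes> Q y"
      using x fun_closed[OF y] by (subst xx) algebra
    also have "\<dots> = x \<otimes> (L y \<otimes> L y \<oplus> Q y) \<oplus> L y \<otimes> Q y"
      unfolding xx using x fun_closed[OF y] by algebra
    finally have xxx: "x \<otimes> (L y \<otimes> L y \<oplus> Q y) \<oplus> L y \<otimes> Q y = x \<otimes> x \<otimes> x" ..
    have "A y \<otimes> x \<ominus> B y = (x \<otimes> (L y \<otimes> L y \<oplus> Q y) \<oplus> L y \<otimes> Q y)
        \<ominus> x \<otimes> y \<otimes> y \<ominus> e \<otimes> y \<otimes> y \<otimes> y \<ominus> (b0 \<oplus> b1 \<otimes> x \<oplus> b2 \<otimes> y)"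
      unfolding A_def B_def using x y e_closed closed fun_closed(1,2)[OF y] by algebra
    also have "\<dots> = cform e x y \<ominus> (b0 \<oplus> b1 \<otimes> x \<oplus> b2 \<otimes> y)"
      unfolding xxx cform_def ..
    also have "\<dots> = \<zero>"
      unfolding g using x y by (simp add: a_minus_def r_neg)
    finally show "A y \<otimes> x = B y"
      by (rule eq_if_minus_zero) (use x fun_closed[OF y] in simp_all)
  qed
  have root: "y \<in> Y" if "(x, y) \<in> S" for x y
  proof -
    have x: "x \<in> carrier R" and y: "y \<in> carrier R" using that by (auto simp: S_def)
    have xx: "x \<otimes> x = x \<otimes> L y \<oplus> Q y" and B_eq: "B y = A y \<otimes> x"
      using reduced[OF that] by simp_all
    \<comment> \<open>With B = A x the resultant becomes A^2 (x^2 - x L - Q), which the conic makes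
      zero.\<close>
    have "r y = A y \<otimes> A y \<otimes> (x \<otimes> x) \<ominus> A y \<otimes> A y \<otimes> (x \<otimes> L y \<oplus> Q y)"
      unfolding r_def B_eq using x fun_closed(1-3)[OF y] by algebra
    also have "\<dots> = \<zero>"
      unfolding xx using x fun_closed(1-3)[OF y] by (simp add: a_minus_def r_neg)
    finally show ?thesis using y by (simp add: Y_def)
  qed
  \<comment> \<open>For fixed y, x is a root of a monic quadratic, hence has at most two values;
    when \<open>A y\<close> is nonzero, the reduced cubic determines x.\<close>
  have fibre: "card {x. (x, y) \<in> S} \<le> (if y \<in> Z then 2 else 1)"
    if y: "y \<in> carrier R" for y
  proof -
    let ?T = "{x \<in> carrier R. x \<otimes> x \<ominus> L y \<otimes> x \<ominus> Q y = \<zero>}"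
    have "poly_fun 2 \<one> (\<lambda>x. x \<otimes> x \<ominus> L y \<otimes> x \<ominus> Q y)"
      by (intro poly_fun_minus_lower[OF _ const] poly_fun_minus_lower[OF _ deg1] yy)
        (use fun_closed[OF y] in simp_all)
    then have T: "finite ?T" "card ?T \<le> 2"
      using card_zeros_poly_fun_le one_not_zero by blast+
    have sub: "{x. (x, y) \<in> S} \<subseteq> ?T"
    proof
      fix x assume xy: "x \<in> {x. (x, y) \<in> S}"
      then have x: "x \<in> carrier R" and xx: "x \<otimes> x = x \<otimes> L y \<oplus> Q y"
        using reduced by (auto simp: S_def)
      have "x \<otimes> x \<ominus> L y \<otimes> x \<ominus> Q y = \<zero>"
        unfolding xx using x fun_closed(1,2)[OF y] by algebra
      with x show "x \<in> ?T" by simp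
    qed
    have card_T: "card {x. (x, y) \<in> S} \<le> 2"
      using card_mono[OF T(1) sub] T(2) by (rule order.trans)
    show "card {x. (x, y) \<in> S} \<le> (if y \<in> Z then 2 else 1)"
    proof (cases "y \<in> Z")
      case True
      with card_T show ?thesis by simp
    next
      case False
      then have Ay: "A y \<noteq> \<zero>" using y by (simp add: Z_def)
      have "x = x'" if "(x, y) \<in> S" "(x', y) \<in> S" for x x'
      proof -
        have "A y \<otimes> x = A y \<otimes> x'" "x \<in> carrier R" "x' \<in> carrier R"
          using reduced[OF that(1)] reduced[OF that(2)] that by (auto simp: S_def)
        with Ay fun_closed[OF y] show ?thesis by (simp add: m_lcancel)
      qed
      then have "card {x. (x, y) \<in> S} \<le> 1"
        using finite_subset[OF sub T(1)] by (simp add: card_le_Suc0_iff_eq)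
      with False show ?thesis by simp
    qed
  qed
  have S_eq: "S = (\<Union>y\<in>Y. (\<lambda>x. (x, y)) ` {x. (x, y) \<in> S})"
    using root by auto
  have YR: "Y \<subseteq> carrier R" by (auto simp: Y_def)
  have "card S \<le> (\<Sum>y\<in>Y. card ((\<lambda>x. (x, y)) ` {x. (x, y) \<in> S}))"
    by (subst S_eq) (rule card_UN_le[OF Y(1)])
  also have "\<dots> = (\<Sum>y\<in>Y. card {x. (x, y) \<in> S})"
    by (intro sum.cong refl card_image) (auto simp: inj_on_def)
  \<comment> \<open>Each fibre counts 1, with 1 more over a zero of \<open>A\<close>, so the total
    is at most |Y| + |Y \<inter> Z|.\<close>
  also have "\<dots> \<le> (\<Sum>y\<in>Y. 1 + (if y \<in> Z then 1 else 0))"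
    by (intro sum_mono order.trans[OF fibre]) (use YR in auto)
  also have "\<dots> = card Y + card (Y \<inter> Z)"
    using Y(1) by (simp only: sum.distrib sum.inter_restrict[symmetric]) simp
  also have "\<dots> \<le> 6 + 2"
    using Y Z card_mono[of Z "Y \<inter> Z"] by (intro add_mono) auto
  finally show "card S \<le> 8" by simp
qed

text \<open>The leading coefficient along the direction (u, v) is b4 g(u, v), or b3 f(u, v) when b4
  = 0. Anisotropy makes it nonzero, so the functional has exact degree 3 or 2 on the line.\<close>

lemma card_section_on_line:
  assumes f: "poly_fun 1 u f" and g: "poly_fun 1 v g" and uv: "(u, v) \<noteq> (\<zero>, \<zero>)"
    and b: "b \<in> {..<5} \<rightarrow> carrier R" and nonlinear: "(b 3, b 4) \<noteq> (\<zero>, \<zero>)"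
  shows "card {t \<in> carrier R. functional_on_surface b (f t) (g t) = \<zero>} \<le> 3"
proof -
  have b_closed: "b 0 \<in> carrier R" "b 1 \<in> carrier R" "b 2 \<in> carrier R" "b 3 \<in> carrier R" "b 4 \<in> carrier R"
    using b by auto
  note uv_closed = poly_fun_closed(1)[OF f] poly_fun_closed(1)[OF g]
  let ?h = "\<lambda>t. b 0 \<oplus> b 1 \<otimes> f t \<oplus> b 2 \<otimes> g t \<oplus> b 3 \<otimes> qform c (f t) (g t)"
  have lin: "poly_fun 1 (b 1 \<otimes> u \<oplus> b 2 \<otimes> v) (\<lambda>t. b 0 \<oplus> b 1 \<otimes> f t \<oplus> b 2 \<otimes> g t)"
    by (intro poly_fun_add poly_fun_add_lower(2)[OF _ poly_fun_const] poly_fun_smult f g b_closed) simp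
  have quad: "poly_fun 2 (b 3 \<otimes> qform c u v) (\<lambda>t. b 3 \<otimes> qform c (f t) (g t))"
    by (intro poly_fun_smult poly_fun_qform f g b_closed c_closed)
  have h: "poly_fun 2 (b 3 \<otimes> qform c u v) ?h"
    by (rule poly_fun_add_lower(2)[OF quad lin]) simp
  show ?thesis
  proof (cases "b 4 = \<zero>")
    case True
    have "{t \<in> carrier R. functional_on_surface b (f t) (g t) = \<zero>} = {t \<in> carrier R. ?h t = \<zero>}"
      using True poly_fun_closed(2)[OF f] poly_fun_closed(2)[OF g] poly_fun_closed(2)[OF h]
      by (auto simp: functional_on_surface_def)
    moreover have "b 3 \<otimes> qform c u v \<noteq> \<zero>"
      using True nonlinear b_closed uv_closed qform_nonzero[OF uv_closed uv] by (simp add: integral_iff)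
    then have "card {t \<in> carrier R. ?h t = \<zero>} \<le> 2"
      using card_zeros_poly_fun_le[OF h] by blast
    ultimately show ?thesis by simp
  next
    case False
    have "poly_fun 3 (b 4 \<otimes> cform e u v) (\<lambda>t. b 4 \<otimes> cform e (f t) (g t))"
      by (intro poly_fun_smult poly_fun_cform f g b_closed e_closed)
    then have "poly_fun 3 (b 4 \<otimes> cform e u v) (\<lambda>t. functional_on_surface b (f t) (g t))"
      unfolding functional_on_surface_def by (rule poly_fun_add_lower(2)[OF _ h]) simp
    moreover have "b 4 \<otimes> cform e u v \<noteq> \<zero>"
      using False b_closed uv_closed cform_nonzero[OF uv_closed uv] by (simp add: integral_iff)
    ultimately show ?thesis
      using card_zeros_poly_fun_le by blast
  qed
qed

text \<open>The line is parametrised by y when \<open>a2\<close> is zero and by x otherwise; either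
  way the direction is nonzero, and the bound along a line applies.\<close>

lemma hyperplane_section_Int_line:
  assumes [simp]: "a1 \<in> carrier R" "a2 \<in> carrier R" "a0 \<in> carrier R"
    and b: "b \<in> {..<5} \<rightarrow> carrier R"
    and line: "(a1, a2) \<noteq> (\<zero>, \<zero>)" and nonlinear: "(b 3, b 4) \<noteq> (\<zero>, \<zero>)"
  shows "card {(x, y) \<in> hyperplane_section b. a0 \<oplus> a1 \<otimes> x \<oplus> a2 \<otimes> y = \<zero>} \<le> 3" (is "card ?S \<le> 3")
proof -
  have bound: "card ?S \<le> 3"
    if f: "poly_fun 1 u f" and g: "poly_fun 1 v g" and uv: "(u, v) \<noteq> (\<zero>, \<zero>)"
      and param: "?S \<subseteq> (\<lambda>t. (f t, g t)) ` carrier R" for u v f g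
  proof -
    let ?T = "{t \<in> carrier R. functional_on_surface b (f t) (g t) = \<zero>}"
    have "?S \<subseteq> (\<lambda>t. (f t, g t)) ` ?T"
      using param by (auto simp: hyperplane_section_def)
    then have "card ?S \<le> card ?T"
      using finite_carrier by (intro surj_card_le) simp_all
    also have "\<dots> \<le> 3"
      using f g uv b nonlinear by (rule card_section_on_line)
    finally show ?thesis .
  qed
  \<comment> \<open>A constant coordinate counts as a function of formal degree 1, with direction
    component zero.\<close>
  have const: "poly_fun 1 \<zero> (\<lambda>t. k)" if "k \<in> carrier R" for k
    by (rule poly_fun_zero_lead[OF poly_fun_const[OF that]]) simp
  show ?thesis
  proof (cases "a2 = \<zero>")
    case True
    then have a1: "a1 \<noteq> \<zero>" using line by simp
    then have "inv a1 \<in> carrier R" by (simp add: field_Units)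
    let ?k = "(\<ominus> (inv a1)) \<otimes> a0"
    have "?S \<subseteq> (\<lambda>t. (?k, t)) ` carrier R"
    proof clarify
      fix x y assume "(x, y) \<in> hyperplane_section b" "a0 \<oplus> a1 \<otimes> x \<oplus> a2 \<otimes> y = \<zero>"
      then have y: "y \<in> carrier R" and "x = ?k"
        using True a1 by (auto simp: hyperplane_section_def intro!: linear_eq_solution)
      then show "(x, y) \<in> (\<lambda>t. (?k, t)) ` carrier R" by blast
    qed
    then show ?thesis
      using \<open>inv a1 \<in> carrier R\<close> by (intro bound[OF const poly_fun_ident]) simp_all
  next
    case False
    then have "inv a2 \<in> carrier R" by (simp add: field_Units)
    let ?g = "\<lambda>t. (\<ominus> (inv a2)) \<otimes> (a0 \<oplus> a1 \<otimes> t)"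
    have "poly_fun 1 ((\<ominus> (inv a2)) \<otimes> (\<zero> \<oplus> a1 \<otimes> \<one>)) ?g"
      using \<open>inv a2 \<in> carrier R\<close>
      by (intro poly_fun_smult poly_fun_add const poly_fun_ident) simp_all
    moreover have "?S \<subseteq> (\<lambda>t. (t, ?g t)) ` carrier R"
    proof clarify
      fix x y assume "(x, y) \<in> hyperplane_section b" "a0 \<oplus> a1 \<otimes> x \<oplus> a2 \<otimes> y = \<zero>"
      then have x: "x \<in> carrier R" and "y = ?g x"
        using False by (auto simp: hyperplane_section_def intro!: linear_eq_solution)
      then show "(x, y) \<in> (\<lambda>t. (t, ?g t)) ` carrier R" by blast
    qed
    ultimately show ?thesis
      by (intro bound[OF poly_fun_ident]) simp_all
  qed
qed

end

section \<open>Functionals annihilating a subspace\<close>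

lemma (in field) coord_space_vectorspace: "vectorspace R (coord_space R n)"
  using func_space_is_module field_axioms by (simp add: vectorspace_def)

text \<open>\<open>dim\<close> is the least size of a finite generating set, and the minimum is
  attained because the finite set \<open>W\<close> generates itself. The last clause is generation
  in the form needed later: a submodule that contains \<open>B\<close> contains
  \<open>W\<close>.\<close>

lemma (in field) subspace_generators:
  assumes fin: "finite (carrier R)" and W: "W \<in> subspaces_of_dim R n d"
  obtains B where "finite B" "card B = d" "B \<subseteq> W"
    "\<forall>N. submodule R N (coord_space R n) \<longrightarrow> B \<subseteq> N \<longrightarrow> W \<subseteq> N"
proof -
  interpret V: vectorspace R "coord_space R n" by (rule coord_space_vectorspace)
  have sub: "VectorSpace.subspace R W (coord_space R n)" and dim: "vectorspace.dim R (V.vs W) = d"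
    using W by (simp_all add: subspaces_of_dim_def)
  have W_sub: "submodule R W (coord_space R n)"
    using sub by (rule V.is_module)
  interpret W: vectorspace R "V.vs W" by (rule V.subspace_is_vs[OF sub])
  have "W \<subseteq> carrier (coord_space R n)"
    using W_sub by (rule submodule.subset)
  also have "finite (carrier (coord_space R n))"
    using fin by (simp add: func_space_def finite_PiE)
  finally (finite_subset) have "finite W" .
  then have "\<exists>B. finite B \<and> card B = card W \<and> B \<subseteq> carrier (V.vs W) \<and> W.gen_set B"
    using W.in_own_span[of W] W.span_is_subset2[of W] by (intro exI[of _ W]) auto
  then have "\<exists>B. finite B \<and> card B = W.dim \<and> B \<subseteq> carrier (V.vs W) \<and> W.gen_set B"
    unfolding W.dim_def by (rule LeastI)
  then obtain B where B: "finite B" "card B = d" "B \<subseteq> W" "W.span B = W"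
    using dim by auto
  have "W \<subseteq> N" if "submodule R N (coord_space R n)" "B \<subseteq> N" for N
    using V.span_is_subset[OF that(2,1)] V.span_li_not_depend(1)[OF B(3) W_sub] B(4) by simp
  then have "\<forall>N. submodule R N (coord_space R n) \<longrightarrow> B \<subseteq> N \<longrightarrow> W \<subseteq> N"
    by blast
  with B(1-3) show thesis by (rule that)
qed

definition (in ring) dot :: "nat \<Rightarrow> (nat \<Rightarrow> 'a) \<Rightarrow> (nat \<Rightarrow> 'a) \<Rightarrow> 'a"
  where "dot n a v = (\<Oplus>j\<in>{..<n}. a j \<otimes> v j)"

text \<open>Serves to pass from generators to the whole subspace: a functional that vanishes on
  generators vanishes on all that they span.\<close>

lemma (in field) annihilator_submodule:
  assumes a: "a \<in> {..<n} \<rightarrow> carrier R"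
  shows "submodule R {v \<in> carrier (coord_space R n). dot n a v = \<zero>} (coord_space R n)"
proof -
  interpret V: vectorspace R "coord_space R n" by (rule coord_space_vectorspace)
  have add: "dot n a (v \<oplus>\<^bsub>coord_space R n\<^esub> w) = dot n a v \<oplus> dot n a w"
    if v: "v \<in> carrier (coord_space R n)" and w: "w \<in> carrier (coord_space R n)" for v w
  proof -
    have v': "v j \<in> carrier R" and w': "w j \<in> carrier R" and a': "a j \<in> carrier R" if "j < n" for j
      using a v w that by (auto simp: func_space_def PiE_def Pi_iff)
    have "dot n a (v \<oplus>\<^bsub>coord_space R n\<^esub> w) = (\<Oplus>j\<in>{..<n}. a j \<otimes> v j \<oplus> a j \<otimes> w j)"
      unfolding dot_def by (rule finsum_cong') (auto simp: func_space_def r_distr v' w' a')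
    also have "\<dots> = dot n a v \<oplus> dot n a w"
      unfolding dot_def by (rule finsum_addf) (auto simp: v' w' a')
    finally show ?thesis .
  qed
  have smult: "dot n a (k \<odot>\<^bsub>coord_space R n\<^esub> v) = k \<otimes> dot n a v"
    if v: "v \<in> carrier (coord_space R n)" and k: "k \<in> carrier R" for v k
  proof -
    have v': "v j \<in> carrier R" and a': "a j \<in> carrier R" if "j < n" for j
      using a v that by (auto simp: func_space_def PiE_def Pi_iff)
    have "dot n a (k \<odot>\<^bsub>coord_space R n\<^esub> v) = (\<Oplus>j\<in>{..<n}. k \<otimes> (a j \<otimes> v j))"
      unfolding dot_def by (rule finsum_cong') (auto simp: func_space_def m_lcomm v' k a')
    also have "\<dots> = k \<otimes> dot n a v"
      unfolding dot_def by (rule finsum_rdistr[symmetric]) (auto simp: v' k a')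
    finally show ?thesis .
  qed
  have zero: "dot n a \<zero>\<^bsub>coord_space R n\<^esub> = \<zero>"
    unfolding dot_def using a by (intro add.finprod_one_eqI) (auto simp: func_space_def Pi_iff)
  show ?thesis
    using V.module_axioms by unfold_locales (auto simp: add smult zero)
qed

text \<open>Vanishing on \<open>d\<close> generators and at coordinate \<open>i\<close> imposes d +
  1 homogeneous conditions on n > d + 1 coefficients, so a nonzero solution exists. The free choice
  of \<open>i\<close> does the elimination between the two equations of a plane.\<close>

lemma (in field) ex_annihilating_functional:
  assumes fin: "finite (carrier R)" and W: "W \<in> subspaces_of_dim R n d"
    and d: "d + 1 < n" and i: "i < n"
  obtains a where "a \<in> {..<n} \<rightarrow> carrier R" "a i = \<zero>" "\<exists>j<n. a j \<noteq> \<zero>"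
    "\<forall>v\<in>W. dot n a v = \<zero>"
proof -
  obtain B where B: "finite B" "card B = d" "B \<subseteq> W"
    "\<forall>N. submodule R N (coord_space R n) \<longrightarrow> B \<subseteq> N \<longrightarrow> W \<subseteq> N"
    by (rule subspace_generators[OF fin W])
  have "submodule R W (coord_space R n)"
    using W by (auto simp: subspaces_of_dim_def VectorSpace.subspace_def)
  then have BV: "B \<subseteq> carrier (coord_space R n)"
    using B(3) submodule.subset by blast
  then have Bj: "v j \<in> carrier R" if "v \<in> B" "j < n" for v j
    using that by (auto simp: func_space_def PiE_def Pi_iff)
  let ?q = "card (carrier R)" and ?D = "{..<n} \<rightarrow>\<^sub>E carrier R"
  \<comment> \<open>Pigeonhole: \<open>T\<close> is additive and has at most \<open>q\<^bsup>d+1\<^esup> < q\<^bsup>n\<^esup>\<close> values.\<close>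
  define T where "T a = (\<lambda>v\<in>B. dot n a v, a i)" for a
  have dot_closed: "dot n a v \<in> carrier R" if "a \<in> {..<n} \<rightarrow> carrier R" "v \<in> B" for a v
    unfolding dot_def using that Bj by (intro finsum_closed) (auto simp: Pi_iff)
  have "T ` ?D \<subseteq> (B \<rightarrow>\<^sub>E carrier R) \<times> carrier R"
    using i dot_closed by (auto simp: T_def PiE_def)
  then have "card (T ` ?D) \<le> card ((B \<rightarrow>\<^sub>E carrier R) \<times> carrier R)"
    using fin B(1) by (intro card_mono) (auto intro: finite_PiE)
  also have "\<dots> = ?q ^ (d + 1)"
    using B(1,2) by (simp add: card_cartesian_product card_PiE)
  also have "\<dots> < ?q ^ n"
  proof (rule power_strict_increasing[OF d])
    have "card {\<zero>, \<one>} \<le> ?q"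
      using fin by (intro card_mono) auto
    then show "1 < ?q" by simp
  qed
  also have "?q ^ n = card ?D"
    by (simp add: card_PiE)
  finally have "\<not> inj_on T ?D"
    by (rule pigeonhole)
  then obtain a1 a2 where a: "a1 \<in> ?D" "a2 \<in> ?D" "T a1 = T a2" "a1 \<noteq> a2"
    by (auto simp: inj_on_def)
  then have aj [simp]: "a1 j \<in> carrier R" "a2 j \<in> carrier R" if "j < n" for j
    using that by (auto simp: PiE_def Pi_iff)
  \<comment> \<open>The difference of two distinct vectors with equal image lies in the kernel of
    \<open>T\<close> and is nonzero.\<close>
  define a where "a j = a1 j \<ominus> a2 j" for j
  have a_closed: "a \<in> {..<n} \<rightarrow> carrier R"
    by (simp add: a_def)
  have "a i = \<zero>"
    using a(3) i by (simp add: T_def a_def)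
  moreover have "\<exists>j<n. a j \<noteq> \<zero>"
  proof -
    obtain j where "j < n" "a1 j \<noteq> a2 j"
      using a(1,2,4) PiE_ext[of a1 "{..<n}" "\<lambda>_. carrier R" a2] by auto
    then show ?thesis by (auto simp: a_def)
  qed
  moreover have "\<forall>v\<in>W. dot n a v = \<zero>"
  proof -
    have "dot n a v = \<zero>" if v: "v \<in> B" for v
    proof -
      have "dot n a v \<oplus> dot n a2 v = (\<Oplus>j\<in>{..<n}. a j \<otimes> v j \<oplus> a2 j \<otimes> v j)"
        unfolding dot_def by (rule finsum_addf[symmetric]) (use Bj v in \<open>auto simp: a_def\<close>)
      also have "\<dots> = dot n a1 v"
        unfolding dot_def
        by (rule finsum_cong') (use Bj v in \<open>auto simp: a_def l_distr[symmetric] a_minus_def a_assoc l_neg\<close>)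
      also have "\<dots> = dot n a2 v"
        using a(3) v by (auto simp: T_def restrict_def fun_eq_iff split: if_splits)
      finally show ?thesis
        using dot_closed[OF a_closed v] dot_closed[OF _ v, of a2] a(2)
        by (metis PiE_def IntE add.r_cancel_one)
    qed
    then have "B \<subseteq> {v \<in> carrier (coord_space R n). dot n a v = \<zero>}"
      using BV by auto
    then have "W \<subseteq> {v \<in> carrier (coord_space R n). dot n a v = \<zero>}"
      using B(4) annihilator_submodule[OF a_closed] by blast
    then show ?thesis by auto
  qed
  ultimately show thesis
    using a_closed that by blast
qed

section \<open>The surface and its plane sections\<close>

context anisotropic_forms
begin

text \<open>The restriction to \<open>{..<5}\<close> is there because members of
  \<open>coord_space\<close> are extensional functions.\<close>

definition surface_vec :: "'a \<Rightarrow> 'a \<Rightarrow> nat \<Rightarrow> 'a"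
  where "surface_vec x y = (\<lambda>i\<in>{..<5}. [\<one>, x, y, qform c x y, cform e x y] ! i)"

lemma surface_vec_nth:
  "surface_vec x y 0 = \<one>" "surface_vec x y 1 = x" "surface_vec x y 2 = y"
  "surface_vec x y 3 = qform c x y" "surface_vec x y 4 = cform e x y"
  by (simp_all add: surface_vec_def)

lemma surface_vec_closed:
  assumes "x \<in> carrier R" "y \<in> carrier R"
  shows "surface_vec x y \<in> carrier (coord_space R 5)"
  using assms by (auto simp: surface_vec_def func_space_def less_Suc_eq numeral_eq_Suc)

lemma dot_surface_vec:
  assumes a: "a \<in> {..<5} \<rightarrow> carrier R" and [simp]: "x \<in> carrier R" "y \<in> carrier R"
  shows "dot 5 a (surface_vec x y) = functional_on_surface a x y"
proof -
  have [simp]: "a 0 \<in> carrier R" "a 1 \<in> carrier R" "a (Suc 0) \<in> carrier R" "a 2 \<in> carrier R" "a 3 \<in> carrier R" "a 4 \<in> carrier R"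
    using a by auto
  have "{..<5::nat} = {0, 1, 2, 3, 4}" by auto
  then have "dot 5 a (surface_vec x y)
      = a 0 \<otimes> \<one> \<oplus> (a 1 \<otimes> x \<oplus> (a 2 \<otimes> y \<oplus> (a 3 \<otimes> qform c x y \<oplus> a 4 \<otimes> cform e x y)))"
    by (simp add: dot_def surface_vec_nth[simplified])
  then show ?thesis
    by (simp add: functional_on_surface_def a_assoc)
qed

section \<open>Intersections of two hyperplane sections\<close>

text \<open>Division by \<open>a 3\<close> and \<open>b 4\<close> brings the equations into the
  shape f = l, g = m with affine l and m, to which the count of conic against cubic applies.\<close>

lemma card_quadratic_inter_cubic_section:
  assumes a: "a \<in> {..<5} \<rightarrow> carrier R" and b: "b \<in> {..<5} \<rightarrow> carrier R"
    and a34: "a 3 \<noteq> \<zero>" "a 4 = \<zero>" and b34: "b 3 = \<zero>" "b 4 \<noteq> \<zero>"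
  shows "card (hyperplane_section a \<inter> hyperplane_section b) \<le> 8"
proof -
  have [simp]: "a 0 \<in> carrier R" "a (Suc 0) \<in> carrier R" "a 2 \<in> carrier R" "a 3 \<in> carrier R"
    "b 0 \<in> carrier R" "b (Suc 0) \<in> carrier R" "b 2 \<in> carrier R" "b 4 \<in> carrier R"
    using a b by auto
  have inv_closed: "inv (a 3) \<in> carrier R" "inv (b 4) \<in> carrier R"
    using a34 b34 by (simp_all add: field_Units)
  have solve: "z = (\<ominus> (inv k3)) \<otimes> k0 \<oplus> (\<ominus> (inv k3)) \<otimes> k1 \<otimes> x \<oplus> (\<ominus> (inv k3)) \<otimes> k2 \<otimes> y"
    if eq: "k0 \<oplus> k1 \<otimes> x \<oplus> k2 \<otimes> y \<oplus> k3 \<otimes> z = \<zero>" and k3: "k3 \<in> carrier R" "k3 \<noteq> \<zero>"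
      and [simp]: "k0 \<in> carrier R" "k1 \<in> carrier R" "k2 \<in> carrier R" "x \<in> carrier R" "y \<in> carrier R" "z \<in> carrier R"
    for k0 k1 k2 k3 x y z
  proof -
    have "inv k3 \<in> carrier R" using k3 by (simp add: field_Units)
    moreover have "z = (\<ominus> (inv k3)) \<otimes> (k0 \<oplus> k1 \<otimes> x \<oplus> k2 \<otimes> y)"
      by (rule linear_eq_solution[OF eq]) (use k3 in simp_all)
    ultimately show ?thesis by (simp add: r_distr m_assoc)
  qed
  let ?l = "\<lambda>a k. (\<ominus> (inv k)) \<otimes> a"
  let ?T = "{(x, y). x \<in> carrier R \<and> y \<in> carrier R \<and>
    qform c x y = ?l (a 0) (a 3) \<oplus> ?l (a 1) (a 3) \<otimes> x \<oplus> ?l (a 2) (a 3) \<otimes> y \<and>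
    cform e x y = ?l (b 0) (b 4) \<oplus> ?l (b 1) (b 4) \<otimes> x \<oplus> ?l (b 2) (b 4) \<otimes> y}"
  have "hyperplane_section a \<inter> hyperplane_section b \<subseteq> ?T"
  proof clarify
    fix x y assume "(x, y) \<in> hyperplane_section a" "(x, y) \<in> hyperplane_section b"
    then have [simp]: "x \<in> carrier R" "y \<in> carrier R"
      and "a 0 \<oplus> a 1 \<otimes> x \<oplus> a 2 \<otimes> y \<oplus> a 3 \<otimes> qform c x y = \<zero>"
      and "b 0 \<oplus> b 1 \<otimes> x \<oplus> b 2 \<otimes> y \<oplus> b 4 \<otimes> cform e x y = \<zero>"
      using a34 b34 by (auto simp: hyperplane_section_def functional_on_surface_def)
    with a34 b34 show "x \<in> carrier R \<and> y \<in> carrier R \<and>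
      qform c x y = ?l (a 0) (a 3) \<oplus> ?l (a 1) (a 3) \<otimes> x \<oplus> ?l (a 2) (a 3) \<otimes> y \<and>
      cform e x y = ?l (b 0) (b 4) \<oplus> ?l (b 1) (b 4) \<otimes> x \<oplus> ?l (b 2) (b 4) \<otimes> y"
      by (intro conjI solve) simp_all
  qed
  moreover have "finite ?T"
    by (rule finite_subset[of _ "carrier R \<times> carrier R"]) (use finite_carrier in auto)
  moreover have "card ?T \<le> 8"
    using inv_closed by (intro card_conic_inter_cubic) simp_all
  ultimately show ?thesis
    using card_mono order.trans by blast
qed

text \<open>The first equation is affine in x and y: either a nonzero constant with no solutions, or
  a line on which the second has at most 3.\<close>

lemma card_linear_inter_nonlinear_section:
  assumes a: "a \<in> {..<5} \<rightarrow> carrier R" and b: "b \<in> {..<5} \<rightarrow> carrier R"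
    and a34: "a 3 = \<zero>" "a 4 = \<zero>" "\<exists>j<5. a j \<noteq> \<zero>" and b34: "(b 3, b 4) \<noteq> (\<zero>, \<zero>)"
  shows "card (hyperplane_section a \<inter> hyperplane_section b) \<le> 3"
proof -
  have [simp]: "a 0 \<in> carrier R" "a (Suc 0) \<in> carrier R" "a 2 \<in> carrier R"
    using a by auto
  have sec: "hyperplane_section a \<inter> hyperplane_section b
      = {(x, y) \<in> hyperplane_section b. a 0 \<oplus> a 1 \<otimes> x \<oplus> a 2 \<otimes> y = \<zero>}"
    using a34(1,2) by (auto simp: hyperplane_section_def functional_on_surface_def)
  show ?thesis
  proof (cases "(a 1, a 2) = (\<zero>, \<zero>)")
    case True
    with a34 have "a 0 \<noteq> \<zero>"
      by (auto simp: less_Suc_eq numeral_eq_Suc)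
    with True have "hyperplane_section a \<inter> hyperplane_section b = {}"
      unfolding sec by (auto simp: hyperplane_section_def)
    then show ?thesis by simp
  next
    case False
    then show ?thesis
      unfolding sec using b b34 by (intro hyperplane_section_Int_line) simp_all
  qed
qed

text \<open>The second equation lacks the variable with index \<open>i\<close>, so if solvable it
  fixes the other one; the first then fixes the remaining variable because \<open>a i\<close> is
  nonzero.\<close>

lemma card_linear_inter_linear_section:
  assumes a: "a \<in> {..<5} \<rightarrow> carrier R" and b: "b \<in> {..<5} \<rightarrow> carrier R"
    and a34: "a 3 = \<zero>" "a 4 = \<zero>" and b34: "b 3 = \<zero>" "b 4 = \<zero>" "\<exists>j<5. b j \<noteq> \<zero>"
    and i: "{i, j} = {1, 2}" "a i \<noteq> \<zero>" "b i = \<zero>"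
  shows "card (hyperplane_section a \<inter> hyperplane_section b) \<le> 1"
proof -
  have cl [simp]: "a 0 \<in> carrier R" "a (Suc 0) \<in> carrier R" "a 2 \<in> carrier R"
    "b 0 \<in> carrier R" "b (Suc 0) \<in> carrier R" "b 2 \<in> carrier R"
    using a b by auto
  have ij: "i = 1 \<and> j = 2 \<or> i = 2 \<and> j = 1" using i(1) by (auto simp: doubleton_eq_iff)
  have "x = x' \<and> y = y'"
    if "(x, y) \<in> hyperplane_section a \<inter> hyperplane_section b"
      "(x', y') \<in> hyperplane_section a \<inter> hyperplane_section b" for x y x' y'
  proof -
    have [simp]: "x \<in> carrier R" "y \<in> carrier R" "x' \<in> carrier R" "y' \<in> carrier R"
      and A: "a 0 \<oplus> a 1 \<otimes> x \<oplus> a 2 \<otimes> y = \<zero>" "a 0 \<oplus> a 1 \<otimes> x' \<oplus> a 2 \<otimes> y' = \<zero>"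
      and B: "b 0 \<oplus> b 1 \<otimes> x \<oplus> b 2 \<otimes> y = \<zero>" "b 0 \<oplus> b 1 \<otimes> x' \<oplus> b 2 \<otimes> y' = \<zero>"
      using that a34 b34 by (auto simp: hyperplane_section_def functional_on_surface_def)
    have unique: "t = t'"
      if "k0 \<oplus> k1 \<otimes> t = \<zero>" "k0 \<oplus> k1 \<otimes> t' = \<zero>" "k1 \<noteq> \<zero>"
        and "k0 \<in> carrier R" "k1 \<in> carrier R" "t \<in> carrier R" "t' \<in> carrier R" for k0 k1 t t'
      using linear_eq_solution[OF that(1,3,4,5,6)] linear_eq_solution[OF that(2,3,4,5,7)] by simp
    from ij show ?thesis
    proof (elim disjE conjE)
      assume ij: "i = 1" "j = 2"
      have B': "b 0 \<oplus> b 2 \<otimes> y = \<zero>" "b 0 \<oplus> b 2 \<otimes> y' = \<zero>"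
        using B i(3) ij by simp_all
      \<comment> \<open>If \<open>b 2\<close> vanished too, the equation would force
        \<open>b 0\<close> to vanish, and no coefficient of \<open>b\<close> would be left.\<close>
      then have "b 2 \<noteq> \<zero>"
        using ij b34 i(3) by (auto simp: less_Suc_eq numeral_eq_Suc)
      with B' have y: "y = y'" by (rule unique) simp_all
      have "(a 0 \<oplus> a 2 \<otimes> y') \<oplus> a 1 \<otimes> x = \<zero>" "(a 0 \<oplus> a 2 \<otimes> y') \<oplus> a 1 \<otimes> x' = \<zero>"
        using A unfolding y by (simp_all add: a_ac)
      then have "x = x'" by (rule unique) (use ij i(2) in simp_all)
      with y show ?thesis by simp
    next
      assume ij: "i = 2" "j = 1"
      have B': "b 0 \<oplus> b 1 \<otimes> x = \<zero>" "b 0 \<oplus> b 1 \<otimes> x' = \<zero>"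
        using B i(3) ij by simp_all
      then have "b 1 \<noteq> \<zero>"
        using ij b34 i(3) by (auto simp: less_Suc_eq numeral_eq_Suc)
      with B' have x: "x = x'" by (rule unique) simp_all
      have "y = y'" by (rule unique[OF A(1)[unfolded x] A(2)]) (use ij i(2) in simp_all)
      with x show ?thesis by simp
    qed
  qed
  then have "\<forall>p \<in> hyperplane_section a \<inter> hyperplane_section b.
      \<forall>p' \<in> hyperplane_section a \<inter> hyperplane_section b. p = p'"
    by (metis prod.collapse)
  then show ?thesis
    by (simp add: card_le_Suc0_iff_eq finite_hyperplane_section)
qed

text \<open>Functionals with a prescribed zero coordinate replace elimination. First
  \<open>a 4\<close> is made zero. If \<open>a 3\<close> is nonzero, \<open>b 3\<close> is made
  zero; otherwise \<open>a\<close> is linear, and \<open>b\<close> is made to vanish at an index 1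
  or 2 where \<open>a\<close> does not, if there is one. The cases give the bounds 8, 3, 1 and
  0.\<close>

lemma card_plane_section:
  assumes W: "W \<in> PG_planes 4 R"
  shows "card {(x, y). x \<in> carrier R \<and> y \<in> carrier R \<and> surface_vec x y \<in> W} \<le> 8" (is "card ?S \<le> 8")
proof -
  have functional: "\<exists>a. a \<in> {..<5} \<rightarrow> carrier R \<and> a i = \<zero> \<and> (\<exists>j<5. a j \<noteq> \<zero>) \<and> ?S \<subseteq> hyperplane_section a"
    if i: "i < 5" for i
  proof -
    obtain a where a: "a \<in> {..<5} \<rightarrow> carrier R" "a i = \<zero>" "\<exists>j<5. a j \<noteq> \<zero>"
      "\<forall>v\<in>W. dot 5 a v = \<zero>"
      by (rule ex_annihilating_functional[OF finite_carrier, of W 5 3 i]) (use W i in \<open>simp_all add: PG_planes_def\<close>)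
    then have "?S \<subseteq> hyperplane_section a"
      by (auto simp: hyperplane_section_def dot_surface_vec[symmetric])
    with a show ?thesis by blast
  qed
  have bound: "card ?S \<le> 8"
    if "?S \<subseteq> hyperplane_section a" "?S \<subseteq> hyperplane_section b"
      "card (hyperplane_section a \<inter> hyperplane_section b) \<le> 8" for a b
    using card_mono[of "hyperplane_section a \<inter> hyperplane_section b" ?S] that finite_hyperplane_section
    by (meson Int_greatest finite_Int order.trans)
  obtain a where a: "a \<in> {..<5} \<rightarrow> carrier R" "a 4 = \<zero>" "\<exists>j<5. a j \<noteq> \<zero>" "?S \<subseteq> hyperplane_section a"
    using functional[of 4] by auto
  show ?thesis
  proof (cases "a 3 = \<zero>")
    case False
    obtain b where b: "b \<in> {..<5} \<rightarrow> carrier R" "b 3 = \<zero>" "\<exists>j<5. b j \<noteq> \<zero>" "?S \<subseteq> hyperplane_section b"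
      using functional[of 3] by auto
    show ?thesis
    proof (cases "b 4 = \<zero>")
      case True
      then have "card (hyperplane_section b \<inter> hyperplane_section a) \<le> 3"
        using False a b by (intro card_linear_inter_nonlinear_section) auto
      with bound[OF b(4) a(4)] show ?thesis by simp
    next
      case b4: False
      show ?thesis
        using False a b b4 by (intro bound[OF a(4) b(4)] card_quadratic_inter_cubic_section) auto
    qed
  next
    case a3: True
    show ?thesis
    proof (cases "a 1 = \<zero> \<and> a 2 = \<zero>")
      case True
      with a a3 have "a 0 \<noteq> \<zero>" "a 0 \<in> carrier R"
        by (auto simp: less_Suc_eq numeral_eq_Suc)
      with True a3 a(2) have "hyperplane_section a = {}"
        by (auto simp: hyperplane_section_def functional_on_surface_def)
      with a(4) have "?S = {}" by blast
      then show ?thesis by (simp only: card.empty)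
    next
      case nz: False
      \<comment> \<open>A zero of \<open>b\<close> at this index, where \<open>a\<close> is nonzero,
        keeps the nonzero \<open>b\<close> from being a multiple of \<open>a\<close>.\<close>
      obtain i j :: nat where ij: "{i, j} = {1, 2}" "a i \<noteq> \<zero>"
      proof (cases "a 1 = \<zero>")
        case True
        with nz show thesis by (intro that[of 2 1]) auto
      next
        case False
        then show thesis by (intro that[of 1 2]) auto
      qed
      then have "i < 5" by (auto simp: doubleton_eq_iff)
      then obtain b where b: "b \<in> {..<5} \<rightarrow> carrier R" "b i = \<zero>" "\<exists>j<5. b j \<noteq> \<zero>" "?S \<subseteq> hyperplane_section b"
        using functional[of i] by auto
      have "card (hyperplane_section a \<inter> hyperplane_section b) \<le> 3"
      proof (cases "b 3 = \<zero> \<and> b 4 = \<zero>")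
        case True
        then have "card (hyperplane_section a \<inter> hyperplane_section b) \<le> 1"
          using a a3 b ij by (intro card_linear_inter_linear_section) auto
        then show ?thesis by simp
      next
        case False
        then show ?thesis
          using a a3 b by (intro card_linear_inter_nonlinear_section) auto
      qed
      with bound[OF a(4) b(4)] show ?thesis by simp
    qed
  qed
qed

section \<open>The surface as a set of projective points\<close>

definition surface_point :: "'a \<Rightarrow> 'a \<Rightarrow> (nat \<Rightarrow> 'a) set"
  where "surface_point x y = LinearCombinations.module.span R (coord_space R 5) {surface_vec x y}"

lemma surface_point_in_PG:
  assumes "x \<in> carrier R" "y \<in> carrier R"
  shows "surface_point x y \<in> PG_points 4 R"
proof -
  interpret V: vectorspace R "coord_space R 5" by (rule coord_space_vectorspace)
  let ?v = "surface_vec x y"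
  have v: "{?v} \<subseteq> carrier (coord_space R 5)" using surface_vec_closed[OF assms] by simp
  have sub: "VectorSpace.subspace R (V.span {?v}) (coord_space R 5)"
    by (rule V.span_is_subspace[OF v])
  interpret P: vectorspace R "V.vs (V.span {?v})" by (rule V.subspace_is_vs[OF sub])
  have v_in: "{?v} \<subseteq> V.span {?v}" by (rule V.in_own_span[OF v])
  have "P.dim = 1"
  proof (rule P.dim1I)
    show "P.gen_set {?v}"
      using V.span_li_not_depend(1)[OF v_in V.is_module[OF sub]] by simp
    \<comment> \<open>Coordinate 0 of the vector is one, so the vector is nonzero and spans a space
      of dimension 1.\<close>
    have "?v 0 \<noteq> \<zero>\<^bsub>coord_space R 5\<^esub> 0"
      by (simp add: surface_vec_nth func_space_def)
    then show "?v \<noteq> \<zero>\<^bsub>V.vs (V.span {?v})\<^esub>" by auto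
    show "?v \<in> carrier (V.vs (V.span {?v}))" using v_in by simp
  qed
  with sub show ?thesis
    by (simp add: PG_points_def subspaces_of_dim_def surface_point_def)
qed

lemma surface_vec_in_point:
  assumes "x \<in> carrier R" "y \<in> carrier R"
  shows "surface_vec x y \<in> surface_point x y"
proof -
  interpret V: vectorspace R "coord_space R 5" by (rule coord_space_vectorspace)
  show ?thesis
    unfolding surface_point_def using V.in_own_span[of "{surface_vec x y}"] surface_vec_closed[OF assms] by simp
qed

text \<open>Equal spans make the vectors proportional; coordinate 0 is one in both, so the factor is
  one, and coordinates 1 and 2 return x and y.\<close>

lemma surface_point_inject:
  assumes xy: "x \<in> carrier R" "y \<in> carrier R" and xy': "x' \<in> carrier R" "y' \<in> carrier R"
    and eq: "surface_point x y = surface_point x' y'"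
  shows "x = x' \<and> y = y'"
proof -
  interpret V: vectorspace R "coord_space R 5" by (rule coord_space_vectorspace)
  let ?v = "surface_vec x' y'"
  have v: "?v \<in> carrier (coord_space R 5)" by (rule surface_vec_closed[OF xy'])
  have "surface_vec x y \<in> V.span {?v}"
    using surface_vec_in_point[OF xy] eq by (simp add: surface_point_def)
  then obtain k where k: "k ?v \<in> carrier R" "surface_vec x y = V.lincomb k {?v}"
    using V.finite_in_span[of "{?v}" "surface_vec x y"] v by auto
  then have *: "surface_vec x y = k ?v \<odot>\<^bsub>coord_space R 5\<^esub> ?v"
    using v by (simp add: V.lincomb_def)
  then have nth: "surface_vec x y i = k ?v \<otimes> ?v i" if "i < 5" for i
    using that by (simp add: func_space_def)
  from nth[of 0] k(1) have "k ?v = \<one>" by (simp add: surface_vec_nth)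
  with nth[of 1] nth[of 2] xy' show ?thesis by (simp add: surface_vec_nth[simplified])
qed

definition surface :: "(nat \<Rightarrow> 'a) set set"
  where "surface = (\<lambda>(x, y). surface_point x y) ` (carrier R \<times> carrier R)"

lemma card_surface: "card surface = card (carrier R) ^ 2"
proof -
  have "inj_on (\<lambda>(x, y). surface_point x y) (carrier R \<times> carrier R)"
  proof (rule inj_onI, clarify)
    fix x y x' y'
    assume "x \<in> carrier R" "y \<in> carrier R" "x' \<in> carrier R" "y' \<in> carrier R"
      "surface_point x y = surface_point x' y'"
    then show "x = x' \<and> y = y'" by (rule surface_point_inject)
  qed
  then show ?thesis
    by (simp only: surface_def card_image card_cartesian_product power2_eq_square)
qed

text \<open>A surface point inside a plane has its vector in the plane, so the number of such points
  is at most the number of parameter pairs, which is at most 8.\<close>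

lemma nine_two_set_surface: "nine_two_set 4 R surface"
  unfolding nine_two_set_def
proof (intro conjI ballI)
  show "surface \<subseteq> PG_points 4 R"
    using surface_point_in_PG by (auto simp: surface_def)
  fix W assume W: "W \<in> PG_planes 4 R"
  let ?S = "{(x, y). x \<in> carrier R \<and> y \<in> carrier R \<and> surface_vec x y \<in> W}"
  have "finite ?S"
    by (rule finite_subset[of _ "carrier R \<times> carrier R"]) (use finite_carrier in auto)
  moreover have "{P \<in> surface. P \<subseteq> W} \<subseteq> (\<lambda>(x, y). surface_point x y) ` ?S"
    using surface_vec_in_point by (fastforce simp: surface_def)
  ultimately have "card {P \<in> surface. P \<subseteq> W} \<le> card ?S"
    by (rule surj_card_le)
  with card_plane_section[OF W] show "card {P \<in> surface. P \<subseteq> W} \<le> 9" by simp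
qed

end

section \<open>Existence over a given finite field and the asymptotics\<close>

lemma ex_nine_two_set:
  fixes K :: "('a, 'm) ring_scheme"
  assumes "field K" and fin: "finite (carrier K)"
  shows "\<exists>X. nine_two_set 4 K X \<and> card X = card (carrier K) ^ 2"
proof -
  interpret field K by fact
  obtain c where "c \<in> carrier K"
    "\<And>x y. \<lbrakk>x \<in> carrier K; y \<in> carrier K; (x, y) \<noteq> (\<zero>\<^bsub>K\<^esub>, \<zero>\<^bsub>K\<^esub>)\<rbrakk> \<Longrightarrow> qform c x y \<noteq> \<zero>\<^bsub>K\<^esub>"
    using ex_anisotropic_qform[OF fin] by blast
  moreover obtain e where "e \<in> carrier K"
    "\<And>x y. \<lbrakk>x \<in> carrier K; y \<in> carrier K; (x, y) \<noteq> (\<zero>\<^bsub>K\<^esub>, \<zero>\<^bsub>K\<^esub>)\<rbrakk> \<Longrightarrow> cform e x y \<noteq> \<zero>\<^bsub>K\<^esub>"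
    using ex_anisotropic_cform[OF fin] by blast
  ultimately interpret anisotropic_forms K c e
    using fin by unfold_locales
  show ?thesis
    using nine_two_set_surface card_surface by blast
qed

text \<open>The cardinality is exactly q^2 at every prime power, so the two sides agree along the
  filter, which expresses q tending to infinity through prime powers only.\<close>

theorem theorem14:
  fixes F :: "nat \<Rightarrow> 'a ring"
  assumes "\<And>q. primepow q \<Longrightarrow> field (F q) \<and> card (carrier (F q)) = q"
  shows "\<exists>X :: nat \<Rightarrow> (nat \<Rightarrow> 'a) set set.
    (\<forall>q. primepow q \<longrightarrow> nine_two_set 4 (F q) (X q)) \<and>
    (\<lambda>q. real (card (X q))) \<sim>[inf at_top (principal {q. primepow q})] (\<lambda>q. real q ^ 2)"
proof -
  have "\<exists>X. nine_two_set 4 (F q) X \<and> card X = q ^ 2" if q: "primepow q" for q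
  proof -
    \<comment> \<open>\<open>card\<close> of an infinite set is 0, so the positive cardinality q
      forces finiteness.\<close>
    have "finite (carrier (F q))"
      using assms[OF q] primepow_gt_0_nat[OF q] card_ge_0_finite by metis
    with ex_nine_two_set[of "F q"] assms[OF q] show ?thesis by simp
  qed
  then obtain X where X: "\<And>q. primepow q \<Longrightarrow> nine_two_set 4 (F q) (X q) \<and> card (X q) = q ^ 2"
    by metis
  have "eventually (\<lambda>q. real (card (X q)) = real q ^ 2) (inf at_top (principal {q. primepow q}))"
    unfolding eventually_inf_principal using X by (intro always_eventually) simp
  then have "(\<lambda>q. real (card (X q))) \<sim>[inf at_top (principal {q. primepow q})] (\<lambda>q. real q ^ 2)"
    by (rule asymp_equiv_refl_ev)
  with X show ?thesis by blast
qed

end
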